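(* Let $G$ be a connected topological group and let $f:G\to\mathbb{R}$ be a nonzero aperiodic homogeneous quasimorphism. Suppose $G^+\in\mathcal M_f(G)$ is closed and satisfies: - $(\dagger)$ The dominant set $G^{++}$ of $G^+$ is open in $G$. - $(\dagger\dagger)$ ${\rm Int}(G^+)$ is path-connected and dense in $G^+$, and there exists a one-parameter semigroup $T:\mathbb{R}^{\ge0}\to G$ with $T(\mathbb{R}^{>0})\subset{\rm Int}(G^+)$. Then $G^+=G^+_{\max}$ is the unique maximal element (with respect to inclusion) of $\mathcal M_f(G)$.
   Context: A quasimorphism on a topological group $G$ is a continuous $f:G\to\mathbb{R}$ with $\sup_{g,h}|f(gh)-f(g)-f(h)|<\infty$; it is homogeneous if $f(g^n)=nf(g)$ for all $g\in G,n\in\mathbb{Z}$. A homogeneous quasimorphism $f$ is aperiodic if the only normal subgroup $H\lhd G$ with $f|_H=0$ is $H=\{e\}$. A bi-invariant partial order $\le$ on $G$ is one preserved by left and right translations; its order semigroup is $G^+=\{g\in G\mid g\ge e\}$. It (and $G^+$) is sandwiched by $f$ if there are $C_1,C_2\in\mathbb{R}$ with $\{g\mid f(g)\ge C_1\}\subset G^+\subset\{g\mid f(g)\ge C_2\}$. $\mathcal M_f(G)$ is the collection of order semigroups of bi-invariant partial orders on $G$ sandwiched by $f$, partially ordered by inclusion. $G^+_{\max}=\{g\in G\mid\forall h\in G:\ f(gh)\ge f(h)\}$. The dominant set of an order with order semigroup $G^+$ is $G^{++}=\{h\in G^+\setminus\{e\}\mid\forall g\in G\ \exists n\in\mathbb{N}:\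 h^n\ge g\}$. A one-parameter semigroup is a continuous map $T:\mathbb{R}^{\ge0}\to G$ with $T(t+s)=T(t)T(s)$ and $T(0)=e$. *)

theory Defs
  imports "HOL-Analysis.Analysis"
begin

text \<open>
  A topological group is a type of class \<open>topological_group_add\<close>. That class is not
  commutative: \<open>g + h\<close> stands for the product $gh$, \<open>0\<close> for $e$ and \<open>- g\<close> for $g^{-1}$.
\<close>

text \<open>The powers $g^n$ in this notation.\<close>

definition npow :: "'a::group_add \<Rightarrow> nat \<Rightarrow> 'a" where
  "npow g n = (((+) g) ^^ n) 0"

definition zpow :: "'a::group_add \<Rightarrow> int \<Rightarrow> 'a" where
  "zpow g n = (if 0 \<le> n then npow g (nat n) else - npow g (nat (- n)))"

definition normal_subgroup :: "'a::group_add set \<Rightarrow> bool" where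
  "normal_subgroup H \<longleftrightarrow>
     0 \<in> H \<and> (\<forall>g\<in>H. \<forall>h\<in>H. g + h \<in> H) \<and> (\<forall>h\<in>H. - h \<in> H) \<and>
     (\<forall>g. \<forall>h\<in>H. g + h + - g \<in> H)"

definition quasimorphism :: "('a::topological_group_add \<Rightarrow> real) \<Rightarrow> bool" where
  "quasimorphism f \<longleftrightarrow>
     continuous_on UNIV f \<and> bdd_above (range (\<lambda>(g, h). \<bar>f (g + h) - f g - f h\<bar>))"

definition homogeneous :: "('a::group_add \<Rightarrow> real) \<Rightarrow> bool" where
  "homogeneous f \<longleftrightarrow> (\<forall>g n. f (zpow g n) = of_int n * f g)"

definition aperiodic :: "('a::group_add \<Rightarrow> real) \<Rightarrow> bool" where
  "aperiodic f \<longleftrightarrow> (\<forall>H. normal_subgroup H \<and> (\<forall>h\<in>H. f h = 0) \<longrightarrow> H = {0})"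

text \<open>A partial order is given by its graph: \<open>(g, h) \<in> r\<close> means $g \le h$.\<close>

definition bi_invariant_order :: "('a::group_add \<times> 'a) set \<Rightarrow> bool" where
  "bi_invariant_order r \<longleftrightarrow>
     partial_order_on UNIV r \<and>
     (\<forall>g h k. (g, h) \<in> r \<longrightarrow> (k + g, k + h) \<in> r \<and> (g + k, h + k) \<in> r)"

definition order_semigroup :: "('a::group_add \<times> 'a) set \<Rightarrow> 'a set" where
  "order_semigroup r = {g. (0, g) \<in> r}"

definition sandwiched :: "('a::group_add \<Rightarrow> real) \<Rightarrow> 'a set \<Rightarrow> bool" where
  "sandwiched f P \<longleftrightarrow> (\<exists>C1 C2. {g. f g \<ge> C1} \<subseteq> P \<and> P \<subseteq> {g. f g \<ge> C2})"

definition sandwiched_semigroups :: "('a::group_add \<Rightarrow> real) \<Rightarrow> 'a set set" where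
  "sandwiched_semigroups f =
     {order_semigroup r | r. bi_invariant_order r \<and> sandwiched f (order_semigroup r)}"

definition max_semigroup :: "('a::group_add \<Rightarrow> real) \<Rightarrow> 'a set" where
  "max_semigroup f = {g. \<forall>h. f (g + h) \<ge> f h}"

text \<open>
  The exponent $n = 0$ is harmless below: if $g \le e$, then already $g \le h^1$.
\<close>

definition dominant_set :: "('a::group_add \<times> 'a) set \<Rightarrow> 'a set" where
  "dominant_set r = {h \<in> order_semigroup r - {0}. \<forall>g. \<exists>n. (g, npow h n) \<in> r}"

definition one_parameter_semigroup :: "(real \<Rightarrow> 'a::topological_group_add) \<Rightarrow> bool" where
  "one_parameter_semigroup T \<longleftrightarrow>
     continuous_on {0..} T \<and> (\<forall>t\<ge>0. \<forall>s\<ge>0. T (t + s) = T t + T s) \<and> T 0 = 0"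

end

theory Submission
  imports Defs
begin

text \<open>
  Two separate arguments give the theorem.

  Order semigroups of bi-invariant orders are the conjugation-invariant submonoids \<open>P\<close> with
  \<open>P \<inter> - P = {0}\<close>. Among those sandwiched by a homogeneous quasimorphism \<open>f\<close>, the set
  \<open>max_semigroup f\<close> is the greatest one. If \<open>p \<in> P\<close>, then \<open>p + h \<ge> h\<close>, so
  \<open>n (p + h) \<ge> n h\<close> for every \<open>n\<close>; as \<open>f\<close> is nonnegative on \<open>P\<close>, this says
  \<open>n f (p + h) \<ge> n f h\<close> up to the defect of \<open>f\<close>, and dividing by \<open>n\<close> shows
  \<open>p \<in> max_semigroup f\<close> (\<open>sandwiched_subset_max_semigroup\<close>). Aperiodicity
  makes \<open>max_semigroup f\<close> itself the order semigroup of an order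
  (\<open>max_semigroup_mem_sandwiched_semigroups\<close>). A greatest element is the only maximal one, so it
  remains to prove \<open>max_semigroup f \<subseteq> P\<close> for the given \<open>P\<close>.

  For this inclusion the point is that \<open>P \<inter> {f > 0}\<close> is relatively clopen in \<open>{f > 0}\<close>: it is
  relatively closed since \<open>P\<close> is closed, and it lies in the dominant set, which is open and
  contained in \<open>P\<close>. Given \<open>g\<close> with \<open>f g > 0\<close>, the ray \<open>t \<mapsto> g + T t\<close> stays in \<open>{f > 0}\<close>, because \<open>T t \<in> P\<close> and \<open>f\<close>
  does not decrease under adding elements of \<open>P\<close>. It ends up in \<open>P\<close>, because \<open>f (T 1) > 0\<close>
  drives \<open>f\<close> to infinity along it. By connectedness of the ray, \<open>g \<in> P\<close>
  (\<open>positive_mem_cone\<close>). If \<open>g \<in> max_semigroup f\<close>, then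
  \<open>f (g + T s) \<ge> f (T s) > 0\<close> for \<open>s > 0\<close>, so \<open>g + T s \<in> P\<close>, and \<open>s \<rightarrow> 0\<close> gives \<open>g \<in> P\<close>.
  The positivity of \<open>f\<close> on the interior of \<open>P\<close> comes from connectedness of the group: it is
  generated by each neighbourhood of \<open>0\<close>, so the multiples of an interior point dominate every
  element (\<open>interior_absorbs\<close>).
\<close>

section \<open>Multiples in a group\<close>

lemma npow_0 [simp]: "npow g 0 = 0"
  by (simp add: npow_def)

lemma npow_Suc [simp]: "npow g (Suc n) = g + npow g n"
  by (simp add: npow_def)

lemma npow_conj: "npow (k + g + - k) n = k + npow g n + - k"
  by (induction n) (simp_all add: add.assoc del: add_uminus_conv_diff)

lemma one_parameter_semigroup_npow:
  assumes "one_parameter_semigroup T"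
  shows "T (real n) = npow (T 1) n"
proof (induction n)
  case 0
  then show ?case using assms by (simp add: one_parameter_semigroup_def)
next
  case (Suc n)
  have "T (1 + real n) = T 1 + T (real n)"
    using assms by (simp add: one_parameter_semigroup_def)
  then show ?case using Suc by simp
qed

section \<open>Positive cones of bi-invariant orders\<close>

definition positive_cone :: "'a::group_add set \<Rightarrow> bool" where
  "positive_cone P \<longleftrightarrow>
     0 \<in> P \<and> (\<forall>g\<in>P. \<forall>h\<in>P. g + h \<in> P) \<and> (\<forall>k. \<forall>g\<in>P. k + g + - k \<in> P) \<and>
     (\<forall>g\<in>P. - g \<in> P \<longrightarrow> g = 0)"

lemma positive_coneD:
  assumes "positive_cone P"
  shows "0 \<in> P" "g \<in> P \<Longrightarrow> h \<in> P \<Longrightarrow> g + h \<in> P" "g \<in> P \<Longrightarrow> k + g + - k \<in> P"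
    "g \<in> P \<Longrightarrow> - g \<in> P \<Longrightarrow> g = 0"
  using assms by (auto simp: positive_cone_def)

lemma bi_invariant_order_iff_diff:
  assumes "bi_invariant_order r"
  shows "(g, h) \<in> r \<longleftrightarrow> h + - g \<in> order_semigroup r"
proof
  assume "(g, h) \<in> r"
  then have "(g + - g, h + - g) \<in> r"
    using assms unfolding bi_invariant_order_def by blast
  then show "h + - g \<in> order_semigroup r"
    by (simp add: order_semigroup_def)
next
  assume "h + - g \<in> order_semigroup r"
  then have "(0 + g, h + - g + g) \<in> r"
    using assms unfolding bi_invariant_order_def order_semigroup_def by blast
  then show "(g, h) \<in> r"
    by (simp add: add.assoc)
qed

lemma positive_cone_order_semigroup:
  assumes r: "bi_invariant_order r"
  shows "positive_cone (order_semigroup r)"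
proof -
  note iff = bi_invariant_order_iff_diff[OF r]
  have refl: "(g, g) \<in> r" for g
    using r by (auto simp: bi_invariant_order_def partial_order_on_def preorder_on_def refl_on_def)
  have trans: "(g, h) \<in> r \<Longrightarrow> (h, k) \<in> r \<Longrightarrow> (g, k) \<in> r" for g h k
    using r unfolding bi_invariant_order_def partial_order_on_def preorder_on_def
    by (meson transD)
  have antisym: "(g, h) \<in> r \<Longrightarrow> (h, g) \<in> r \<Longrightarrow> g = h" for g h
    using r unfolding bi_invariant_order_def partial_order_on_def by (meson antisymD)
  have inv: "(g, h) \<in> r \<Longrightarrow> (k + g, k + h) \<in> r" "(g, h) \<in> r \<Longrightarrow> (g + k, h + k) \<in> r" for g h k
    using r unfolding bi_invariant_order_def by blast+
  show ?thesis
    unfolding positive_cone_def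
  proof (intro conjI ballI allI impI)
    show "0 \<in> order_semigroup r"
      using refl by (simp add: order_semigroup_def)
  next
    fix g h assume "g \<in> order_semigroup r" "h \<in> order_semigroup r"
    then show "g + h \<in> order_semigroup r"
      using inv(1)[of 0 h g] trans[of 0 g "g + h"] by (simp add: order_semigroup_def)
  next
    fix k g assume "g \<in> order_semigroup r"
    then show "k + g + - k \<in> order_semigroup r"
      using inv(2)[OF inv(1), of 0 g k "- k"] by (simp add: order_semigroup_def)
  next
    fix g assume "g \<in> order_semigroup r" "- g \<in> order_semigroup r"
    then show "g = 0"
      using antisym[of 0 g] iff[of g 0] by (simp add: order_semigroup_def)
  qed
qed

lemma positive_cone_imp_order:
  assumes P: "positive_cone P"
  obtains r where "bi_invariant_order r" "order_semigroup r = P"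
proof
  let ?r = "{(g, h). h + - g \<in> P}"
  note cone = positive_coneD[OF P]
  have trans: "k + - g \<in> P" if "h + - g \<in> P" "k + - h \<in> P" for g h k
    using cone(2)[OF that(2,1)] by (simp add: add.assoc del: add_uminus_conv_diff)
  have antisym: "g = h" if "h + - g \<in> P" "g + - h \<in> P" for g h
    using cone(4)[OF that(1)] that(2) by (simp add: minus_add)
  have left: "(k + h) + - (k + g) \<in> P" if "h + - g \<in> P" for g h k
    using cone(3)[OF that, of k] by (simp add: minus_add add.assoc del: add_uminus_conv_diff)
  have right: "(h + k) + - (g + k) \<in> P" if "h + - g \<in> P" for g h k
    using that by (simp add: minus_add add.assoc del: add_uminus_conv_diff)
  show "bi_invariant_order ?r"
    unfolding bi_invariant_order_def partial_order_on_def preorder_on_def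
  proof (intro conjI allI impI)
    show "?r \<subseteq> UNIV \<times> UNIV" "refl_on UNIV ?r" using cone(1) by (simp_all add: refl_on_def)
    show "trans ?r" using trans by (blast intro: transI)
    show "antisym ?r" using antisym by (blast intro: antisymI)
  qed (use left right in blast)+
  show "order_semigroup ?r = P"
    by (simp add: order_semigroup_def)
qed

lemma sandwiched_semigroups_eq:
  "sandwiched_semigroups f = {P. positive_cone P \<and> sandwiched f P}"
  unfolding sandwiched_semigroups_def
  using positive_cone_order_semigroup positive_cone_imp_order by blast

text \<open>
  Adding a positive element on the left is an increase, and multiples respect the order even
  though the group is not commutative: the conjugates that arise stay in the cone.
\<close>

lemma positive_cone_npow_diff:
  assumes "positive_cone P" "p \<in> P"
  shows "npow (p + h) n + - npow h n \<in> P"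
proof (induction n)
  case 0
  then show ?case using positive_coneD(1)[OF assms(1)] by simp
next
  case (Suc n)
  have "p + (h + (npow (p + h) n + - npow h n) + - h) \<in> P"
    using positive_coneD(2)[OF assms(1,2) positive_coneD(3)[OF assms(1) Suc, of h]]
    by (simp add: add.assoc del: add_uminus_conv_diff)
  then show ?case
    by (simp add: minus_add add.assoc del: add_uminus_conv_diff)
qed

lemma positive_cone_npow:
  assumes "positive_cone P" "p \<in> P"
  shows "npow p n \<in> P"
  using positive_coneD(1,2)[OF assms(1)] assms(2) by (induction n) simp_all

section \<open>Absorption by interior points\<close>

lemma open_translate:
  fixes U :: "'a::topological_group_add set"
  assumes "open U"
  shows "open {x. a + x \<in> U}"
  using open_vimage[OF assms, of "(+) a"]
  by (simp add: vimage_def continuous_intros)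

text \<open>
  The elements \<open>g\<close> absorbed by the multiples of an interior point \<open>h\<close> form a set that is stable
  under adding elements of the neighbourhood \<open>U\<close> of \<open>0\<close> with \<open>h + U \<subseteq> P\<close>. Such a set is open,
  and for symmetric \<open>U\<close> so is its complement.
\<close>

lemma interior_absorbs:
  fixes P :: "'a::topological_group_add set"
  assumes "connected (UNIV :: 'a set)" "positive_cone P" "h \<in> interior P"
  shows "\<exists>k. npow h k + g \<in> P"
proof -
  note cone = positive_coneD[OF assms(2)]
  define U where "U = {u. h + u \<in> interior P} \<inter> {u. h + - u \<in> interior P}"
  have "open (uminus -` {u. h + u \<in> interior P})"
    by (intro open_vimage open_translate open_interior continuous_intros)
  then have "open U"
    unfolding U_def vimage_def mem_Collect_eq by (intro open_Int open_translate open_interior)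
  have "0 \<in> U" using assms(3) by (simp add: U_def)
  have U_uminus: "- u \<in> U" if "u \<in> U" for u
    using that by (simp add: U_def)
  define H where "H = {g. \<exists>k. npow h k + g \<in> P}"
  have step: "g + u \<in> H" if g: "g \<in> H" and u: "u \<in> U" for g u
  proof -
    obtain k where k: "npow h k + g \<in> P" using g by (auto simp: H_def)
    have "h + u \<in> P" using u interior_subset by (auto simp: U_def)
    \<comment> \<open>conjugation makes room for the extra summand \<open>h\<close> directly in front of \<open>u\<close>\<close>
    then have "(h + (npow h k + g) + - h) + (h + u) \<in> P"
      using cone(2)[OF cone(3)[OF k]] by blast
    then have "npow h (Suc k) + (g + u) \<in> P"
      by (simp add: add.assoc del: add_uminus_conv_diff)
    then show ?thesis unfolding H_def by blast
  qed
  have nbhd: "open {x. - g + x \<in> U}" "g \<in> {x. - g + x \<in> U}" for g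
    using open_translate[OF \<open>open U\<close>] \<open>0 \<in> U\<close> by auto
  have "open H"
  proof (rule topological_space_class.openI)
    fix g assume "g \<in> H"
    then have "x \<in> H" if "- g + x \<in> U" for x
      using step[OF _ that, of g] by (simp add: add.assoc[symmetric])
    then show "\<exists>V. open V \<and> g \<in> V \<and> V \<subseteq> H"
      using nbhd[of g] by blast
  qed
  moreover have "open (- H)"
  proof (rule topological_space_class.openI)
    fix g assume "g \<in> - H"
    moreover have "g \<in> H" if "- g + x \<in> U" "x \<in> H" for x
      using step[OF that(2) U_uminus[OF that(1)]] by (simp add: minus_add add.assoc[symmetric])
    ultimately show "\<exists>V. open V \<and> g \<in> V \<and> V \<subseteq> - H"
      using nbhd[of g] by blast
  qed
  moreover have "0 \<in> H"
    unfolding H_def using cone(1) by (auto intro: exI[of _ 0])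
  ultimately have "H = UNIV"
    using connectedD[OF assms(1), of H "- H"] by auto
  then show ?thesis unfolding H_def by blast
qed

section \<open>Homogeneous quasimorphisms\<close>

text \<open>The device by which homogeneity absorbs bounded errors.\<close>

lemma le_of_multiples_le:
  fixes x y c :: real
  assumes "\<And>n. real n * x \<le> real n * y + c"
  shows "x \<le> y"
proof (rule ccontr)
  assume "\<not> x \<le> y"
  then obtain n where "c < real n * (x - y)"
    using reals_Archimedean3[of "x - y"] by auto
  then show False using assms[of n] by (simp add: algebra_simps)
qed

locale homogeneous_quasimorphism =
  fixes f :: "'a::topological_group_add \<Rightarrow> real"
  assumes quasimorphism: "quasimorphism f" and homogeneous: "homogeneous f"
begin

lemma f_npow: "f (npow g n) = real n * f g"
proof -
  have "f (zpow g (int n)) = of_int (int n) * f g"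
    using homogeneous by (simp only: homogeneous_def)
  then show ?thesis by (simp add: zpow_def)
qed

lemma f_uminus: "f (- g) = - f g"
proof -
  have "f (zpow g (- 1)) = of_int (- 1) * f g"
    using homogeneous by (simp only: homogeneous_def)
  then show ?thesis by (simp add: zpow_def)
qed

lemma f_0 [simp]: "f 0 = 0"
  using f_npow[of 0 0] by simp

lemma defect_bound:
  obtains D where "\<And>g h. \<bar>f (g + h) - f g - f h\<bar> \<le> D"
proof -
  obtain D where "\<forall>x \<in> range (\<lambda>(g, h). \<bar>f (g + h) - f g - f h\<bar>). x \<le> D"
    using quasimorphism by (auto simp: quasimorphism_def bdd_above_def)
  then have "\<bar>f (g + h) - f g - f h\<bar> \<le> D" for g h
    by (auto dest: spec[of _ g])
  then show ?thesis using that by blast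
qed

text \<open>
  Conjugation commutes with taking multiples, so it changes \<open>n f g\<close> by no more than twice the
  defect, whatever \<open>n\<close> is.
\<close>

lemma f_conj_le: "f (k + g + - k) \<le> f g"
proof -
  obtain D where D: "\<And>g h. \<bar>f (g + h) - f g - f h\<bar> \<le> D" by (rule defect_bound) blast
  show ?thesis
  proof (rule le_of_multiples_le)
    fix n
    have "f (npow (k + g + - k) n) \<le> f (npow g n) + 2 * D"
      using D[of "k + npow g n" "- k"] D[of k "npow g n"] unfolding npow_conj f_uminus by linarith
    then show "real n * f (k + g + - k) \<le> real n * f g + 2 * D"
      by (simp add: f_npow)
  qed
qed

lemma f_conj: "f (k + g + - k) = f g"
  using f_conj_le[of k g] f_conj_le[of "- k" "k + g + - k"] by (simp add: add.assoc)

lemma f_add_commute: "f (g + h) = f (h + g)"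
  using f_conj[of g "h + g"] by (simp add: add.assoc del: add_uminus_conv_diff)

text \<open>All multiples of \<open>p\<close> stay in \<open>P\<close>, so \<open>n f p\<close> is bounded below in \<open>n\<close>.\<close>

lemma sandwiched_nonneg:
  assumes "positive_cone P" "sandwiched f P" "p \<in> P"
  shows "0 \<le> f p"
proof -
  obtain C where "P \<subseteq> {g. C \<le> f g}"
    using assms(2) unfolding sandwiched_def by blast
  then have "C \<le> real n * f p" for n
    using positive_cone_npow[OF assms(1,3), of n] by (auto simp: f_npow)
  then have "real n * 0 \<le> real n * f p + - C" for n
    by simp
  then show ?thesis by (rule le_of_multiples_le)
qed

lemma sandwiched_subset_max_semigroup:
  assumes P: "positive_cone P" "sandwiched f P"
  shows "P \<subseteq> max_semigroup f"
proof
  fix p assume p: "p \<in> P"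
  obtain D where D: "\<And>g h. \<bar>f (g + h) - f g - f h\<bar> \<le> D" by (rule defect_bound) blast
  have "f h \<le> f (p + h)" for h
  proof (rule le_of_multiples_le)
    fix n
    have "0 \<le> f (npow (p + h) n + - npow h n)"
      using sandwiched_nonneg[OF P] positive_cone_npow_diff[OF P(1) p] by blast
    also have "\<dots> \<le> f (npow (p + h) n) - f (npow h n) + D"
      using D[of "npow (p + h) n" "- npow h n"] by (simp add: f_uminus)
    finally show "real n * f h \<le> real n * f (p + h) + D"
      by (simp add: f_npow)
  qed
  then show "p \<in> max_semigroup f"
    by (simp add: max_semigroup_def)
qed

text \<open>
  Antisymmetry is where aperiodicity enters: the elements \<open>g\<close> with \<open>g\<close> and \<open>- g\<close> both in
  \<open>max_semigroup f\<close> are the periods of \<open>f\<close>, and they form a normal subgroup on which \<open>f\<close>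
  takes the value \<open>f 0 = 0\<close>. An element \<open>g\<close> belongs to \<open>max_semigroup f\<close> as soon as \<open>f g\<close>
  is at least the defect of \<open>f\<close>.
\<close>

lemma max_semigroup_mem_sandwiched_semigroups:
  assumes "aperiodic f"
  shows "max_semigroup f \<in> sandwiched_semigroups f"
proof -
  let ?S = "max_semigroup f"
  obtain D where D: "\<And>g h. \<bar>f (g + h) - f g - f h\<bar> \<le> D" by (rule defect_bound) blast
  have add: "g + h \<in> ?S" if "g \<in> ?S" "h \<in> ?S" for g h
    using that unfolding max_semigroup_def by (auto simp: add.assoc intro: order_trans)
  have conj: "k + g + - k \<in> ?S" if g: "g \<in> ?S" for k g
    unfolding max_semigroup_def
  proof (intro CollectI allI)
    fix h
    have "f h = f (- k + h + k)"
      using f_conj[of "- k" h] by simp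
    also have "\<dots> \<le> f (g + (- k + h + k))"
      using g by (simp add: max_semigroup_def)
    also have "\<dots> = f (k + (g + (- k + h + k)) + - k)"
      by (simp only: f_conj)
    also have "\<dots> = f (k + g + - k + h)"
      by (simp add: add.assoc del: add_uminus_conv_diff)
    finally show "f h \<le> f (k + g + - k + h)" .
  qed
  let ?H = "{g. g \<in> ?S \<and> - g \<in> ?S}"
  have "normal_subgroup ?H"
    unfolding normal_subgroup_def
  proof (intro conjI ballI allI)
    show "0 \<in> ?H" by (simp add: max_semigroup_def)
    show "g + h \<in> ?H" if "g \<in> ?H" "h \<in> ?H" for g h
      using that add[of g h] add[of "- h" "- g"] by (simp add: minus_add)
    show "- h \<in> ?H" if "h \<in> ?H" for h
      using that by simp
    show "k + h + - k \<in> ?H" if "h \<in> ?H" for k h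
      using that conj[of h k] conj[of "- h" k]
      by (simp add: minus_add add.assoc del: add_uminus_conv_diff)
  qed
  moreover have "f h = 0" if "h \<in> ?H" for h
  proof -
    have "f 0 \<le> f (h + 0)" "f 0 \<le> f (- h + 0)"
      using that unfolding max_semigroup_def by blast+
    then show ?thesis by (simp add: f_uminus)
  qed
  ultimately have "?H = {0}"
    using assms unfolding aperiodic_def by blast
  then have "positive_cone ?S"
    unfolding positive_cone_def using add conj by (auto simp: max_semigroup_def)
  moreover have "{g. D \<le> f g} \<subseteq> ?S"
  proof
    fix g assume "g \<in> {g. D \<le> f g}"
    then have "f h \<le> f (g + h)" for h
      using D[of g h] by simp
    then show "g \<in> ?S" by (simp add: max_semigroup_def)
  qed
  moreover have "?S \<subseteq> {g. 0 \<le> f g}"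
    by (auto simp: max_semigroup_def dest: spec[of _ 0])
  ultimately show ?thesis
    unfolding sandwiched_semigroups_eq sandwiched_def by blast
qed

section \<open>Positivity on the interior of a cone\<close>

lemma unbounded_below:
  assumes "\<exists>g. f g \<noteq> 0"
  obtains g where "f g < c"
proof -
  obtain g0 where "f g0 \<noteq> 0" using assms by blast
  then obtain g where g: "0 < f g"
    using f_uminus[of g0] by (metis neg_0_less_iff_less linorder_neqE_linordered_idom)
  then obtain n where "- c < real n * f g"
    using reals_Archimedean3 by blast
  then have "f (- npow g n) < c"
    by (simp add: f_uminus f_npow)
  then show ?thesis by (rule that)
qed

lemma interior_positive:
  assumes "connected (UNIV :: 'a set)" "\<exists>g. f g \<noteq> 0"
    and P: "positive_cone P" "sandwiched f P" and h: "h \<in> interior P"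
  shows "0 < f h"
proof (rule ccontr)
  assume "\<not> 0 < f h"
  obtain D where D: "\<And>g h. \<bar>f (g + h) - f g - f h\<bar> \<le> D" by (rule defect_bound) blast
  \<comment> \<open>an element so negative that no multiple of \<open>h\<close> can absorb it unless \<open>f h > 0\<close>\<close>
  obtain g where g: "f g < - D" using unbounded_below[OF assms(2)] .
  obtain k where "npow h k + g \<in> P"
    using interior_absorbs[OF assms(1) P(1) h] by blast
  then have "0 \<le> f (npow h k + g)" by (rule sandwiched_nonneg[OF P])
  also have "\<dots> \<le> real k * f h + f g + D"
    using D[of "npow h k" g] by (simp add: f_npow)
  also have "\<dots> < 0"
    using g \<open>\<not> 0 < f h\<close> mult_nonneg_nonpos[of "real k" "f h"] by simp
  finally show False by simp
qed

section \<open>Filling up the half-space where the quasimorphism is positive\<close>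

text \<open>
  If \<open>f h > 0\<close>, then \<open>f (n h - g)\<close> tends to infinity with \<open>n\<close> and passes the threshold above
  which every element is positive.
\<close>

lemma positive_mem_dominant_set:
  assumes r: "bi_invariant_order r" "sandwiched f (order_semigroup r)"
    and h: "h \<in> order_semigroup r" "0 < f h"
  shows "h \<in> dominant_set r"
proof -
  obtain D where D: "\<And>g h. \<bar>f (g + h) - f g - f h\<bar> \<le> D" by (rule defect_bound) blast
  obtain C where C: "{g. C \<le> f g} \<subseteq> order_semigroup r"
    using r(2) unfolding sandwiched_def by blast
  have "\<exists>n. (g, npow h n) \<in> r" for g
  proof -
    obtain n where "C + D + f g < real n * f h"
      using reals_Archimedean3[OF h(2)] by blast
    then have "C \<le> f (npow h n + - g)"
      using D[of "npow h n" "- g"] by (simp add: f_npow f_uminus)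
    then show ?thesis
      using C bi_invariant_order_iff_diff[OF r(1)] by blast
  qed
  then show ?thesis
    using h unfolding dominant_set_def by auto
qed

text \<open>
  The ray \<open>g + T t\<close> is a connected subset of \<open>{f > 0}\<close> that meets \<open>P\<close>. The dominant set and the
  complement of \<open>P\<close> are disjoint open sets that cover \<open>{f > 0}\<close>, so the ray cannot leave \<open>P\<close>.
\<close>

lemma positive_mem_cone:
  assumes conn: "connected (UNIV :: 'a set)" and nonzero: "\<exists>g. f g \<noteq> 0"
    and r: "bi_invariant_order r" "sandwiched f (order_semigroup r)"
    and closed: "closed (order_semigroup r)" and dom: "open (dominant_set r)"
    and T: "one_parameter_semigroup T" "T ` {0<..} \<subseteq> interior (order_semigroup r)"
    and g: "0 < f g"
  shows "g \<in> order_semigroup r"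
proof -
  define P where "P = order_semigroup r"
  have P: "positive_cone P" "sandwiched f P"
    using r positive_cone_order_semigroup by (auto simp: P_def)
  have T0: "T 0 = 0" and contT: "continuous_on {0..} T"
    using T(1) by (auto simp: one_parameter_semigroup_def)
  have T_interior: "T t \<in> interior P" if "0 < t" for t
    unfolding P_def using that by (intro subsetD[OF T(2)] imageI) simp
  have TP: "T t \<in> P" if "0 \<le> t" for t
  proof (cases "t = 0")
    case True
    then show ?thesis using T0 positive_coneD(1)[OF P(1)] by simp
  next
    case False
    then show ?thesis using that T_interior[of t] interior_subset[of P] by auto
  qed
  define A where "A = (\<lambda>t. g + T t) ` {0..}"
  have "connected A"
    unfolding A_def by (intro connected_continuous_image continuous_intros contT connected_Ici)
  have A_pos: "0 < f x" if x: "x \<in> A" for x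
  proof -
    obtain t where t: "0 \<le> t" "x = g + T t" using x unfolding A_def by blast
    have "T t \<in> max_semigroup f"
      using TP[OF t(1)] sandwiched_subset_max_semigroup[OF P] by blast
    \<comment> \<open>the ray adds \<open>T t\<close> on the right, \<open>max_semigroup f\<close> speaks of adding on the left\<close>
    then have "f g \<le> f x"
      unfolding t(2) f_add_commute[of g] by (simp add: max_semigroup_def)
    then show ?thesis using g by simp
  qed
  have "A \<inter> P \<noteq> {}"
  proof -
    obtain D where D: "\<And>g h. \<bar>f (g + h) - f g - f h\<bar> \<le> D" by (rule defect_bound) blast
    obtain C where C: "{g. C \<le> f g} \<subseteq> P"
      using P(2) unfolding sandwiched_def by blast
    have "0 < f (T 1)"
      by (intro interior_positive[OF conn nonzero P] T_interior) simp
    then obtain n where "C + D - f g < real n * f (T 1)"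
      using reals_Archimedean3 by blast
    then have "C \<le> f (g + T (real n))"
      using D[of g "T (real n)"] by (simp add: one_parameter_semigroup_npow[OF T(1)] f_npow)
    then have "g + T (real n) \<in> P"
      using C by auto
    moreover have "g + T (real n) \<in> A"
      unfolding A_def by (rule imageI) simp
    ultimately show ?thesis by blast
  qed
  moreover have AP: "A \<inter> P \<subseteq> dominant_set r"
    using A_pos positive_mem_dominant_set[OF r] by (auto simp: P_def)
  moreover have "dominant_set r \<subseteq> P"
    by (auto simp: dominant_set_def P_def)
  moreover have "open (- P)" using closed unfolding P_def by (rule open_Compl)
  ultimately have "A \<subseteq> P"
    using connectedD[OF \<open>connected A\<close> dom \<open>open (- P)\<close>] by blast
  moreover have "g + T 0 \<in> A"
    unfolding A_def by (rule imageI) simp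
  ultimately have "g + T 0 \<in> P" by blast
  then show ?thesis using T0 by (simp add: P_def)
qed

lemma max_semigroup_subset_cone:
  assumes conn: "connected (UNIV :: 'a set)" and nonzero: "\<exists>g. f g \<noteq> 0"
    and r: "bi_invariant_order r" "sandwiched f (order_semigroup r)"
    and closed: "closed (order_semigroup r)" and dom: "open (dominant_set r)"
    and T: "one_parameter_semigroup T" "T ` {0<..} \<subseteq> interior (order_semigroup r)"
  shows "max_semigroup f \<subseteq> order_semigroup r"
proof
  fix g assume g: "g \<in> max_semigroup f"
  have "g + T s \<in> order_semigroup r" if "0 < s" for s
  proof -
    have "0 < f (T s)"
      using that
      by (intro interior_positive[OF conn nonzero positive_cone_order_semigroup[OF r(1)] r(2)]
          subsetD[OF T(2)] imageI) simp
    also have "\<dots> \<le> f (g + T s)" using g by (simp add: max_semigroup_def)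
    finally show ?thesis by (rule positive_mem_cone[OF assms])
  qed
  then have ev: "\<forall>\<^sub>F s in at_right 0. g + T s \<in> order_semigroup r"
    by (simp add: eventually_at_filter)
  have "continuous_on {0..} T"
    using T(1) by (simp add: one_parameter_semigroup_def)
  then have "(T \<longlongrightarrow> T 0) (at 0 within {0..})"
    by (simp add: continuous_on_def)
  then have "(T \<longlongrightarrow> T 0) (at_right 0)"
    by (rule tendsto_within_subset) auto
  then have "((\<lambda>s. g + T s) \<longlongrightarrow> g + T 0) (at_right 0)"
    by (intro tendsto_intros)
  from Lim_in_closed_set[OF closed ev _ this]
  show "g \<in> order_semigroup r"
    using T(1) by (simp add: one_parameter_semigroup_def)
qed

end

section \<open>The maximal order\<close>

theorem theorem2p20:
  fixes f :: "'a::topological_group_add \<Rightarrow> real"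
    and r :: "('a \<times> 'a) set"
  assumes "connected (UNIV :: 'a set)"
    and "quasimorphism f" and "homogeneous f" and "aperiodic f" and "\<exists>g. f g \<noteq> 0"
    and "bi_invariant_order r"
    and "order_semigroup r \<in> sandwiched_semigroups f"
    and "closed (order_semigroup r)"
    and dagger: "open (dominant_set r)"
    and ddagger: "path_connected (interior (order_semigroup r))"
      "order_semigroup r \<subseteq> closure (interior (order_semigroup r))"
      "\<exists>T. one_parameter_semigroup T \<and> T ` {0<..} \<subseteq> interior (order_semigroup r)"
  shows "order_semigroup r = max_semigroup f \<and>
    {M \<in> sandwiched_semigroups f. \<forall>N \<in> sandwiched_semigroups f. M \<subseteq> N \<longrightarrow> N = M}
      = {order_semigroup r}"
proof -
  interpret homogeneous_quasimorphism f
    using assms(2,3) by unfold_locales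
  have greatest: "M \<subseteq> max_semigroup f" if "M \<in> sandwiched_semigroups f" for M
    using that unfolding sandwiched_semigroups_eq mem_Collect_eq
    by (elim conjE) (rule sandwiched_subset_max_semigroup)
  have "sandwiched f (order_semigroup r)"
    using assms(7) unfolding sandwiched_semigroups_eq mem_Collect_eq by (rule conjunct2)
  moreover obtain T where "one_parameter_semigroup T" "T ` {0<..} \<subseteq> interior (order_semigroup r)"
    using ddagger(3) by (elim exE conjE)
  ultimately have "max_semigroup f \<subseteq> order_semigroup r"
    by (rule max_semigroup_subset_cone[OF assms(1,5,6) _ assms(8) dagger])
  then have eq: "order_semigroup r = max_semigroup f"
    by (rule subset_antisym[OF greatest[OF assms(7)]])
  have "M \<in> sandwiched_semigroups f \<and> (\<forall>N\<in>sandwiched_semigroups f. M \<subseteq> N \<longrightarrow> N = M) \<longleftrightarrow>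
      M = max_semigroup f" for M
    using greatest max_semigroup_mem_sandwiched_semigroups[OF assms(4)]
    by (metis subset_antisym)
  then show ?thesis
    by (simp add: eq)
qed

end
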